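(* Let $\mathcal C=\{\mathcal C_1,\dots,\mathcal C_K\}$ be a clustering of $\mathcal V=\{1,\dots,n\}$, let $\Upsilon=\{\mathcal G_1,\dots,\mathcal G_m\}$ be a finite set of directed graphs on $\mathcal V$, and let $\{A(t)\}_{t\ge 0}$ be a sequence of $n\times n$ stochastic matrices with $\mathcal G(A(t))\in\Upsilon$ for all $t$. Suppose: ($\mathcal A$) for each pair $p,q$ of cluster indices, either there are no links from $\mathcal C_q$ to $\mathcal C_p$ in any $\mathcal G_l$, $l=1,\dots,m$, or for each vertex $v\in\mathcal C_p$ and each graph $\mathcal G_l$, $l=1,\dots,m$, there is at least one link from $\mathcal C_q$ to $v$ in $\mathcal G_l$; ($\mathcal B_1$) there is a constant $e>0$ such that for all $i,j$ and $t$, either $A_{ij}(t)=0$ or $A_{ij}(t)\ge e$; ($\mathcal B_2$) $A_{ii}(t)\ge e$ for all $i=1,\dots,n$ and $t\ge 0$; ($\mathcal B_3$) for each $t$ there is a $K\times K$ stochastic matrix $B(t)=[b_{p,q}(t)]$ such that $\sum_{j\in\mathcal C_q}A_{ij}(t)=b_{p,q}(t)$ for all $i\in\mathcal C_p$ and all $p,q=1,\dots,K$. Let $\alpha_1,\dots,\alpha_K$ be pairwise different real constants, let $u:\{0,1,2,\dots\}\to\mathbb R$, and consider the system $$x_i(t+1)=\sum_{j=1}^n A_{ij}(t)x_j(t)+I_i(t),\qquad I_i(t)=\alpha_p u(t)\ \text{ for } i\in\mathcal C_p,\ p=1,\dots,K,\ t\ge 0.$$ If there exists an integer $L>0$ such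 that for every time interval $[t,t+L)$ of length $L$ the union graph $\mathcal G\big(\sum_{i=t}^{t+L-1}A(i)\big)$ has cluster-spanning-trees with respect to $\mathcal C$, then the system intra-cluster synchronizes: for every $x(0)\in\mathbb R^n$, $\lim_{t\to\infty}|x_i(t)-x_{i'}(t)|=0$ for all $i,i'\in\mathcal C_p$ and all $p=1,\dots,K$.
   Context: A clustering of $\mathcal V=\{1,\dots,n\}$ is a partition $\mathcal C=\{\mathcal C_1,\dots,\mathcal C_K\}$ of $\mathcal V$. A stochastic matrix is a nonnegative square matrix with all row sums equal to $1$. The directed graph $\mathcal G(A)$ of a nonnegative $n\times n$ matrix $A$ has vertex set $\mathcal V$ and has an edge (link) $(j,i)$ from $j$ to $i$ if and only if $A_{ij}>0$. A directed graph on $\mathcal V$ has cluster-spanning-trees with respect to $\mathcal C$ if for each $p$ there is a vertex $v_p\in\mathcal V$ (not necessarily in $\mathcal C_p$) with directed paths (possibly of length $0$, possibly through vertices outside $\mathcal C_p$) from $v_p$ to all vertices of $\mathcal C_p$. *)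

theory Defs
  imports "HOL-Analysis.Analysis" "HOL-Library.Disjoint_Sets" "Graph_Theory.Pair_Digraph"
begin

text \<open>
  The vertex set is the universe of a finite type \<open>'n\<close>, and the cluster indices are the
  elements of a finite type \<open>'k\<close>. Injectivity makes the indexing of the clusters free of
  repetitions; \<^const>\<open>partition_on\<close> makes all clusters nonempty.
\<close>

definition clustering :: "('k::finite \<Rightarrow> 'n::finite set) \<Rightarrow> bool" where
  "clustering C \<longleftrightarrow> partition_on UNIV (range C) \<and> inj C"

definition stochastic_matrix :: "real ^ 'n ^ 'n::finite \<Rightarrow> bool" where
  "stochastic_matrix A \<longleftrightarrow> (\<forall>i j. 0 \<le> A $ i $ j) \<and> (\<forall>i. (\<Sum>j\<in>UNIV. A $ i $ j) = 1)"

text \<open>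
  The link from \<open>j\<close> to \<open>i\<close> corresponds to the entry in row \<open>i\<close> and column \<open>j\<close>, so the
  indices are transposed. Self-loops are allowed.
\<close>

definition matrix_digraph :: "real ^ 'n ^ 'n::finite \<Rightarrow> 'n pair_pre_digraph" where
  "matrix_digraph A = \<lparr>pverts = UNIV, parcs = {(j, i). A $ i $ j > 0}\<rparr>"

text \<open>
  The root \<open>v\<close> need not belong to the cluster, and \<^const>\<open>reachable\<close> refers to paths in the
  whole graph, including the path of length 0.
\<close>

definition has_cluster_spanning_trees ::
    "'n pair_pre_digraph \<Rightarrow> ('k \<Rightarrow> 'n set) \<Rightarrow> bool" where
  "has_cluster_spanning_trees G C \<longleftrightarrow>
    (\<forall>p. \<exists>v\<in>pverts G. \<forall>w\<in>C p. reachable (with_proj G) v w)"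

primrec trajectory ::
    "(nat \<Rightarrow> real ^ 'n ^ 'n::finite) \<Rightarrow> (nat \<Rightarrow> real ^ 'n) \<Rightarrow> real ^ 'n \<Rightarrow> nat \<Rightarrow> real ^ 'n" where
  "trajectory A I x0 0 = x0"
| "trajectory A I x0 (Suc t) = A t *v trajectory A I x0 t + I t"

definition intra_cluster_synchronizes ::
    "('k \<Rightarrow> 'n set) \<Rightarrow> (nat \<Rightarrow> real ^ 'n ^ 'n::finite) \<Rightarrow> (nat \<Rightarrow> real ^ 'n) \<Rightarrow> bool" where
  "intra_cluster_synchronizes C A I \<longleftrightarrow>
    (\<forall>x0 p. \<forall>i\<in>C p. \<forall>i'\<in>C p.
      (\<lambda>t. \<bar>trajectory A I x0 t $ i - trajectory A I x0 t $ i'\<bar>) \<longlonglongrightarrow> 0)"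

end

theory Submission
  imports Defs
begin

text \<open>
  Two rows of a product of the matrices that belong to the same cluster have equal sums over every
  cluster. Hence, if they share a column in which both are at least \<open>\<delta>\<close>, the product shrinks the
  maximal intra-cluster difference by the factor \<open>1 - \<delta>\<close> (a clustered Hajnal inequality), and
  inputs that are constant on clusters do not affect these differences. To find a shared column,
  follow the supports of the two rows backwards in time. By the self-loops they never shrink, and
  while they are disjoint, one of them misses the root of the cluster in the union graph of the
  next window of length \<open>L\<close>, so that a path from the root enters it and it grows. After more than
  \<open>n\<close> windows they must meet.
\<close>

text \<open>The property in \<open>cond_B3\<close> with the quotient matrix \<open>B\<close>
  eliminated: the common sum over \<open>C q\<close> of the rows in \<open>C p\<close> is the entry
  \<open>B $ p $ q\<close>.\<close>

definition cluster_stochastic :: "('k \<Rightarrow> 'n set) \<Rightarrow> real ^ 'n ^ 'n::finite \<Rightarrow> bool" where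
  "cluster_stochastic C M \<longleftrightarrow> stochastic_matrix M \<and>
    (\<forall>p q. \<forall>i\<in>C p. \<forall>i'\<in>C p. (\<Sum>j\<in>C q. M $ i $ j) = (\<Sum>j\<in>C q. M $ i' $ j))"

text \<open>The condition \<open>cond_B1\<close> for one matrix. It turns the bare positivity of an
  entry into a quantitative bound, which is what a contraction factor needs.\<close>

definition entries_gap :: "real \<Rightarrow> real ^ 'n ^ 'm \<Rightarrow> bool" where
  "entries_gap e M \<longleftrightarrow> (\<forall>i j. M $ i $ j = 0 \<or> e \<le> M $ i $ j)"

definition cluster_constant :: "('k \<Rightarrow> 'n set) \<Rightarrow> real ^ 'n \<Rightarrow> bool" where
  "cluster_constant C w \<longleftrightarrow> (\<forall>p. \<forall>i\<in>C p. \<forall>i'\<in>C p. w $ i = w $ i')"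

text \<open>One-sided because \<open>i\<close> and \<open>i'\<close> range over all ordered pairs,
  so that the bound on the absolute value is included. No maximum over the clusters has to be
  formed.\<close>

definition cluster_diff_le :: "('k \<Rightarrow> 'n set) \<Rightarrow> real \<Rightarrow> real ^ 'n \<Rightarrow> bool" where
  "cluster_diff_le C d x \<longleftrightarrow> (\<forall>p. \<forall>i\<in>C p. \<forall>i'\<in>C p. x $ i - x $ i' \<le> d)"

text \<open>The product of the \<open>k\<close> matrices from time \<open>t\<close> on, the latest
  one leftmost. The recursion splits off the earliest factor, so inductions on \<open>k\<close>
  generalize over the starting time.\<close>

primrec transition :: "(nat \<Rightarrow> real ^ 'n ^ 'n) \<Rightarrow> nat \<Rightarrow> nat \<Rightarrow> real ^ 'n ^ 'n::finite" where
  "transition A t 0 = mat 1"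
| "transition A t (Suc k) = transition A (Suc t) k ** A t"

lemma transition_add:
  "transition A t (a + b) = transition A (t + a) b ** transition A t a"
  by (induction a arbitrary: t) (simp_all add: matrix_mul_assoc)

section \<open>Stochastic matrices with constant cluster sums\<close>

lemma sum_clusters:
  fixes C :: "'k::finite \<Rightarrow> 'n::finite set" and f :: "'n \<Rightarrow> real"
  assumes "clustering C"
  shows "(\<Sum>j\<in>UNIV. f j) = (\<Sum>q\<in>UNIV. \<Sum>j\<in>C q. f j)"
proof -
  have P: "partition_on UNIV (range C)" and inj: "inj C"
    using assms by (auto simp: clustering_def)
  have "C q \<inter> C q' = {}" if "q \<noteq> q'" for q q'
    using disjointD [OF partition_onD2 [OF P]] inj_eq [OF inj] that by simp
  moreover have "(\<Union>q. C q) = UNIV"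
    using P by (auto simp: partition_on_def)
  ultimately show ?thesis
    by (subst sum.UNION_disjoint [symmetric]) auto
qed

lemma stochastic_matrix_le_one:
  assumes "stochastic_matrix M"
  shows "M $ i $ j \<le> 1"
proof -
  have "M $ i $ j \<le> (\<Sum>j\<in>UNIV. M $ i $ j)"
    using assms by (intro member_le_sum) (auto simp: stochastic_matrix_def)
  with assms show ?thesis by (simp add: stochastic_matrix_def)
qed

lemma stochastic_matrix_mat_1: "stochastic_matrix (mat 1)"
  by (simp add: stochastic_matrix_def mat_def)

text \<open>Since \<open>w\<close> has a single value on each cluster, a component of
  \<open>M *v w\<close> depends only on the sums of its row of \<open>M\<close> over the
  clusters.\<close>

lemma mult_cluster_constant_eq:
  fixes C :: "'k::finite \<Rightarrow> 'n::finite set"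
  assumes C: "clustering C" and M: "cluster_stochastic C M"
    and w: "cluster_constant C w" and i: "i \<in> C p" "i' \<in> C p"
  shows "(M *v w) $ i = (M *v w) $ i'"
proof -
  have "(\<Sum>j\<in>C q. M $ i $ j * w $ j) = (\<Sum>j\<in>C q. M $ i' $ j * w $ j)" for q
  proof (cases "C q = {}")
    case False
    then obtain j0 where j0: "j0 \<in> C q" by blast
    have *: "(\<Sum>j\<in>C q. M $ l $ j * w $ j) = (\<Sum>j\<in>C q. M $ l $ j) * w $ j0" for l
      unfolding sum_distrib_right
    proof (rule sum.cong)
      fix j
      assume "j \<in> C q"
      with w j0 have "w $ j = w $ j0"
        unfolding cluster_constant_def by blast
      then show "M $ l $ j * w $ j = M $ l $ j * w $ j0" by simp
    qed simp
    have "(\<Sum>j\<in>C q. M $ i $ j) = (\<Sum>j\<in>C q. M $ i' $ j)"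
      using M i unfolding cluster_stochastic_def by blast
    then show ?thesis
      by (simp only: *)
  qed simp
  then show ?thesis
    by (simp add: matrix_vector_mult_def sum_clusters [OF C])
qed

lemma cluster_constant_mult:
  assumes "clustering C" "cluster_stochastic C M" "cluster_constant C w"
  shows "cluster_constant C (M *v w)"
  using mult_cluster_constant_eq [OF assms] unfolding cluster_constant_def by blast

lemma cluster_constant_add:
  assumes "cluster_constant C v" "cluster_constant C w"
  shows "cluster_constant C (v + w)"
  unfolding cluster_constant_def
proof (intro allI ballI)
  fix p i i'
  assume "i \<in> C p" "i' \<in> C p"
  then have "v $ i = v $ i'" "w $ i = w $ i'"
    using assms unfolding cluster_constant_def by blast+
  then show "(v + w) $ i = (v + w) $ i'" by simp
qed

text \<open>Multiplying \<open>M\<close> by the indicator vector of \<open>C q\<close> gives the row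
  sums over \<open>C q\<close>. Closure under products then follows from associativity, as both
  factors preserve cluster-constant vectors.\<close>

lemma cluster_stochastic_iff:
  fixes C :: "'k::finite \<Rightarrow> 'n::finite set"
  shows "cluster_stochastic C M \<longleftrightarrow> stochastic_matrix M \<and>
    (\<forall>q. cluster_constant C (M *v (\<chi> j. of_bool (j \<in> C q))))"
proof -
  have "(M *v (\<chi> j. of_bool (j \<in> C q))) $ i = (\<Sum>j\<in>C q. M $ i $ j)" for q i
    by (auto simp: matrix_vector_mult_def intro: sum.mono_neutral_cong_right)
  then have "cluster_constant C (M *v (\<chi> j. of_bool (j \<in> C q))) \<longleftrightarrow>
      (\<forall>p. \<forall>i\<in>C p. \<forall>i'\<in>C p. (\<Sum>j\<in>C q. M $ i $ j) = (\<Sum>j\<in>C q. M $ i' $ j))" for q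
    unfolding cluster_constant_def by (simp only:)
  then show ?thesis
    unfolding cluster_stochastic_def by (simp only:) blast
qed

lemma cluster_constant_indicator:
  assumes "clustering C"
  shows "cluster_constant C (\<chi> j. of_bool (j \<in> C q))"
proof -
  have "C p = C q" if "i \<in> C p" "i \<in> C q" for p i
    using assms that unfolding clustering_def partition_on_def disjoint_def by blast
  then show ?thesis
    unfolding cluster_constant_def by fastforce
qed

lemma stochastic_matrix_mult:
  assumes M: "stochastic_matrix M" and N: "stochastic_matrix N"
  shows "stochastic_matrix (M ** N)"
  unfolding stochastic_matrix_def
proof (intro conjI allI)
  fix i j
  show "0 \<le> (M ** N) $ i $ j"
    using assms by (auto simp: stochastic_matrix_def matrix_matrix_mult_def intro!: sum_nonneg)
next
  fix i
  have "(\<Sum>j\<in>UNIV. (M ** N) $ i $ j) = (\<Sum>l\<in>UNIV. M $ i $ l * (\<Sum>j\<in>UNIV. N $ l $ j))"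
    by (simp add: matrix_matrix_mult_def sum_distrib_left) (rule sum.swap)
  also have "\<dots> = 1"
    using M N by (simp add: stochastic_matrix_def)
  finally show "(\<Sum>j\<in>UNIV. (M ** N) $ i $ j) = 1" .
qed

lemma cluster_stochastic_mult:
  fixes C :: "'k::finite \<Rightarrow> 'n::finite set"
  assumes C: "clustering C" and M: "cluster_stochastic C M" and N: "cluster_stochastic C N"
  shows "cluster_stochastic C (M ** N)"
proof -
  have "cluster_constant C ((M ** N) *v (\<chi> j. of_bool (j \<in> C q)))" for q
    unfolding matrix_vector_mul_assoc [symmetric]
    by (intro cluster_constant_mult C M N cluster_constant_indicator)
  moreover have "stochastic_matrix (M ** N)"
    using M N by (auto simp: cluster_stochastic_def intro: stochastic_matrix_mult)
  ultimately show ?thesis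
    unfolding cluster_stochastic_iff by blast
qed

lemma cluster_stochastic_transition:
  fixes C :: "'k::finite \<Rightarrow> 'n::finite set"
  assumes C: "clustering C" and A: "\<And>t. cluster_stochastic C (A t)"
  shows "cluster_stochastic C (transition A t k)"
proof (induction k arbitrary: t)
  case 0
  show ?case
    unfolding cluster_stochastic_iff transition.simps matrix_vector_mul_lid
    using stochastic_matrix_mat_1 cluster_constant_indicator [OF C] by blast
next
  case (Suc k)
  show ?case
    unfolding transition.simps by (intro cluster_stochastic_mult C Suc A)
qed

section \<open>Positive entries of products\<close>

lemma matrix_mult_pos_iff:
  fixes M N :: "real ^ 'n ^ 'n::finite"
  assumes "\<And>i j. 0 \<le> M $ i $ j" "\<And>i j. 0 \<le> N $ i $ j"
  shows "0 < (M ** N) $ i $ j \<longleftrightarrow> (\<exists>l. 0 < M $ i $ l \<and> 0 < N $ l $ j)"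
proof -
  have "0 < (M ** N) $ i $ j \<longleftrightarrow> (\<exists>l. M $ i $ l * N $ l $ j \<noteq> 0)"
    unfolding matrix_matrix_mult_def
    using assms by (simp add: less_le sum_nonneg sum_nonneg_eq_0_iff eq_commute [of 0])
  then show ?thesis
    using assms by (simp add: less_le eq_commute [of 0])
qed

text \<open>A positive entry of the product contains a term with two positive factors. That term is
  at least \<open>d * e\<close>, and the other terms are nonnegative.\<close>

lemma entries_gap_mult:
  fixes M N :: "real ^ 'n ^ 'n::finite"
  assumes M: "stochastic_matrix M" "entries_gap d M" and N: "stochastic_matrix N" "entries_gap e N"
    and pos: "0 < d" "0 < e"
  shows "entries_gap (d * e) (M ** N)"
  unfolding entries_gap_def
proof (intro allI)
  fix i j
  have nn: "0 \<le> M $ i $ j" "0 \<le> N $ i $ j" for i j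
    using M N by (auto simp: stochastic_matrix_def)
  show "(M ** N) $ i $ j = 0 \<or> d * e \<le> (M ** N) $ i $ j"
  proof (cases "0 < (M ** N) $ i $ j")
    case True
    then obtain l where l: "0 < M $ i $ l" "0 < N $ l $ j"
      using nn by (auto simp: matrix_mult_pos_iff)
    then have "d \<le> M $ i $ l" "e \<le> N $ l $ j"
      using M(2) N(2) unfolding entries_gap_def by (metis less_irrefl)+
    then have "d * e \<le> M $ i $ l * N $ l $ j"
      using pos by (intro mult_mono) auto
    also have "\<dots> \<le> (M ** N) $ i $ j"
      unfolding matrix_matrix_mult_def
      using nn by (simp add: member_le_sum [of l UNIV "\<lambda>l. M $ i $ l * N $ l $ j"])
    finally show ?thesis ..
  next
    case False
    moreover have "0 \<le> (M ** N) $ i $ j"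
      using stochastic_matrix_mult [OF M(1) N(1)] by (simp add: stochastic_matrix_def)
    ultimately show ?thesis by simp
  qed
qed

lemma stochastic_transition:
  assumes "\<And>t. stochastic_matrix (A t)"
  shows "stochastic_matrix (transition A t k)"
  by (induction k arbitrary: t) (simp_all add: stochastic_matrix_mat_1 stochastic_matrix_mult assms)

lemma entries_gap_transition:
  assumes "\<And>t. stochastic_matrix (A t)" "\<And>t. entries_gap e (A t)" "0 < e"
  shows "entries_gap (e ^ k) (transition A t k)"
proof (induction k arbitrary: t)
  case 0
  show ?case by (simp add: entries_gap_def mat_def)
next
  case (Suc k)
  have "entries_gap (e ^ k * e) (transition A (Suc t) k ** A t)"
    using assms by (intro entries_gap_mult stochastic_transition Suc) auto
  then show ?case by (simp add: mult.commute)
qed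

lemma transition_pos_diag:
  assumes A: "\<And>t. stochastic_matrix (A t)" and diag: "\<And>t i. 0 < A t $ i $ i"
  shows "0 < transition A t k $ i $ i"
proof (induction k arbitrary: t)
  case 0
  show ?case by (simp add: mat_def)
next
  case (Suc k)
  have "0 \<le> A t $ i $ j" "0 \<le> transition A (Suc t) k $ i $ j" for i j
    using A stochastic_transition [where A = A, OF A] by (auto simp: stochastic_matrix_def)
  with Suc diag show ?case
    by (auto simp: matrix_mult_pos_iff)
qed

text \<open>Wait at \<open>j\<close> on self-loops for the \<open>a\<close> steps before time
  \<open>s\<close>, move along the link to \<open>i\<close> at time \<open>s\<close>, and wait at
  \<open>i\<close> for the remaining \<open>b\<close> steps.\<close>

lemma transition_pos_arc:
  assumes A: "\<And>t. stochastic_matrix (A t)" and diag: "\<And>t i. 0 < A t $ i $ i"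
    and s: "s \<in> {t..<t + L}" and arc: "0 < A s $ i $ j"
  shows "0 < transition A t L $ i $ j"
proof -
  define a b where "a = s - t" and "b = L - Suc a"
  then have ab: "L = a + Suc b" "s = t + a"
    using s by auto
  have nn: "0 \<le> A t $ i $ j" "0 \<le> transition A t k $ i $ j" for i j t k
    using A stochastic_transition [where A = A, OF A] by (auto simp: stochastic_matrix_def)
  have "0 < transition A s (Suc b) $ i $ j"
    using arc transition_pos_diag [where A = A, OF A diag] nn by (auto simp: matrix_mult_pos_iff)
  then show ?thesis
    unfolding ab transition_add
    using transition_pos_diag [where A = A, OF A diag] nn by (subst matrix_mult_pos_iff) (auto simp: ab simp del: transition.simps)
qed

section \<open>Common columns of two rows in one cluster\<close>

lemma reachable_enters:
  assumes "reachable (with_proj (matrix_digraph M)) v w" "v \<notin> S" "w \<in> S"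
  obtains a b where "a \<notin> S" "b \<in> S" "0 < M $ b $ a"
proof -
  have "(v, w) \<in> rtrancl_on UNIV {(j, i). 0 < M $ i $ j}"
    using assms(1) by (simp add: reachable_def matrix_digraph_def arcs_ends_def arc_to_ends_def with_proj_def)
  \<comment> \<open>Induction along the path: if the last vertex but one is already in
    \<open>S\<close>, an earlier link has entered \<open>S\<close>; otherwise the last link
    does.\<close>
  then have "w \<in> S \<longrightarrow> (\<exists>a b. a \<notin> S \<and> b \<in> S \<and> 0 < M $ b $ a)"
    using assms(2) by (induction rule: rtrancl_on_induct) auto
  with assms(3) that show thesis by blast
qed

text \<open>The induction prepends the window starting at \<open>t\<close> to the \<open>k\<close>
  windows after it. Both supports can only gain columns, so a common column persists; if there was
  none, at least one support gains a column and the sum of the cardinalities increases.\<close>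

lemma supports_meet_or_grow:
  fixes A :: "nat \<Rightarrow> real ^ 'n ^ 'n::finite"
  assumes A: "\<And>t. stochastic_matrix (A t)" and diag: "\<And>t i. 0 < A t $ i $ i"
    and tree: "\<And>t. has_cluster_spanning_trees (matrix_digraph (\<Sum>s\<in>{t..<t + L}. A s)) C"
    and i: "i \<in> C p" "i' \<in> C p"
  defines "S \<equiv> \<lambda>t k i. {j. 0 < transition A t (k * L) $ i $ j}"
  shows "S t k i \<inter> S t k i' \<noteq> {} \<or> k \<le> card (S t k i) + card (S t k i')"
proof (induction k arbitrary: t)
  case 0
  show ?case by simp
next
  case (Suc k)
  have nn: "0 \<le> transition A t k $ i $ j" for i j t k
    using stochastic_transition [where A = A, OF A] by (auto simp: stochastic_matrix_def)
  have step: "j \<in> S t (Suc k) i" if "l \<in> S (t + L) k i" "0 < transition A t L $ l $ j" for i j l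
    using that nn unfolding S_def
    by (auto simp: transition_add matrix_mult_pos_iff)
  have sub: "S (t + L) k i \<subseteq> S t (Suc k) i" for i
    using step transition_pos_diag [where A = A, OF A diag] by blast
  have mem: "i \<in> S t k i" for i t k
    using transition_pos_diag [where A = A, OF A diag] by (simp add: S_def)
  \<comment> \<open>The support of row \<open>l\<close> contains \<open>l\<close> itself, so a path
    from \<open>v\<close> outside to \<open>l\<close> enters it by some link from \<open>a\<close>
    to \<open>b\<close>. This link occurs at some time in the window, which makes \<open>a\<close> a
    new column.\<close>
  have grow: "S (t + L) k l \<subset> S t (Suc k) l"
    if reach: "reachable (with_proj (matrix_digraph (\<Sum>s\<in>{t..<t + L}. A s))) v l"
      and v: "v \<notin> S (t + L) k l" for v l
  proof -
    obtain a b where ab: "a \<notin> S (t + L) k l" "b \<in> S (t + L) k l"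
      "0 < (\<Sum>s\<in>{t..<t + L}. A s) $ b $ a"
      using reachable_enters [OF reach v mem] .
    from ab(3) have "\<exists>s\<in>{t..<t + L}. 0 < A s $ b $ a"
      by (rule contrapos_pp) (auto simp: not_less intro: sum_nonpos)
    then obtain s where "s \<in> {t..<t + L}" "0 < A s $ b $ a" by blast
    then have "0 < transition A t L $ b $ a"
      by (rule transition_pos_arc [where A = A, OF A diag])
    with step ab sub show ?thesis by blast
  qed
  obtain v where v: "\<And>w. w \<in> C p \<Longrightarrow>
      reachable (with_proj (matrix_digraph (\<Sum>s\<in>{t..<t + L}. A s))) v w"
    using tree unfolding has_cluster_spanning_trees_def by blast
  have card: "card (S (t + L) k l) \<le> card (S t (Suc k) l)"
    "S (t + L) k l \<subset> S t (Suc k) l \<Longrightarrow> card (S (t + L) k l) < card (S t (Suc k) l)" for l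
    using sub by (simp_all add: card_mono psubset_card_mono)
  show ?case
  proof (cases "S (t + L) k i \<inter> S (t + L) k i' = {}")
    case False
    with sub show ?thesis by blast
  next
    case True
    \<comment> \<open>A single root \<open>v\<close> reaches both \<open>i\<close> and
      \<open>i'\<close>, and disjoint supports cannot both contain it.\<close>
    then consider "v \<notin> S (t + L) k i" | "v \<notin> S (t + L) k i'" by blast
    then have "card (S (t + L) k i) + card (S (t + L) k i') <
        card (S t (Suc k) i) + card (S t (Suc k) i')"
      by cases (use card grow v i in \<open>meson add_less_le_mono add_le_less_mono\<close>)+
    with Suc [of "t + L"] True show ?thesis by linarith
  qed
qed

text \<open>Disjoint supports have at most \<open>CARD('n)\<close> columns together, one less than
  the number of windows.\<close>

lemma supports_meet:
  fixes A :: "nat \<Rightarrow> real ^ 'n ^ 'n::finite"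
  assumes A: "\<And>t. stochastic_matrix (A t)" and diag: "\<And>t i. 0 < A t $ i $ i"
    and tree: "\<And>t. has_cluster_spanning_trees (matrix_digraph (\<Sum>s\<in>{t..<t + L}. A s)) C"
    and i: "i \<in> C p" "i' \<in> C p"
  obtains j where "0 < transition A t (Suc CARD('n) * L) $ i $ j"
    "0 < transition A t (Suc CARD('n) * L) $ i' $ j"
proof -
  define S where "S = (\<lambda>i. {j. 0 < transition A t (Suc CARD('n) * L) $ i $ j})"
  have "S i \<inter> S i' \<noteq> {} \<or> Suc CARD('n) \<le> card (S i) + card (S i')"
    using supports_meet_or_grow [where A = A, OF A diag tree i] unfolding S_def .
  moreover have "card (S i) + card (S i') \<le> CARD('n)" if "S i \<inter> S i' = {}"
    using that card_mono [of UNIV "S i \<union> S i'"] by (simp add: card_Un_disjoint)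
  ultimately have "S i \<inter> S i' \<noteq> {}" by linarith
  with that show thesis unfolding S_def by blast
qed

section \<open>Contraction of intra-cluster differences\<close>

text \<open>The difference \<open>c\<close> of the two rows sums to zero over each cluster, so
  \<open>x\<close> may be shifted there to take values between 0 and \<open>d\<close>. Then only the
  positive part of \<open>c\<close> counts; its total is 1 minus the overlap of the rows, and the
  column \<open>j0\<close> makes the overlap at least \<open>\<delta>\<close>.\<close>

lemma cluster_diff_contraction:
  fixes C :: "'k::finite \<Rightarrow> 'n::finite set"
  assumes C: "clustering C" and M: "cluster_stochastic C M" and x: "cluster_diff_le C d x"
    and i: "i \<in> C p" "i' \<in> C p"
    and j0: "\<delta> \<le> M $ i $ j0" "\<delta> \<le> M $ i' $ j0"
  shows "(M *v x) $ i - (M *v x) $ i' \<le> (1 - \<delta>) * d"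
proof -
  have nn: "0 \<le> M $ i $ j" for i j
    using M by (auto simp: cluster_stochastic_def stochastic_matrix_def)
  have row: "(\<Sum>j\<in>UNIV. M $ i $ j) = 1" for i
    using M by (simp add: cluster_stochastic_def stochastic_matrix_def)
  have d: "0 \<le> d"
    using x i unfolding cluster_diff_le_def by force
  define c where "c j = M $ i $ j - M $ i' $ j" for j
  have cluster: "(\<Sum>j\<in>C q. c j * x $ j) \<le> (\<Sum>j\<in>C q. max (c j) 0 * d)" for q
  proof (cases "C q = {}")
    case False
    define m where "m = Min (($) x ` C q)"
    have m: "m \<le> x $ j" "x $ j \<le> m + d" if j: "j \<in> C q" for j
    proof -
      show "m \<le> x $ j" using j by (simp add: m_def)
      have "m \<in> ($) x ` C q"
        unfolding m_def using False by (intro Min_in) auto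
      then show "x $ j \<le> m + d"
        using x j unfolding cluster_diff_le_def by (smt (verit) imageE)
    qed
    have "(\<Sum>j\<in>C q. M $ i $ j) = (\<Sum>j\<in>C q. M $ i' $ j)"
      using M i unfolding cluster_stochastic_def by blast
    then have "(\<Sum>j\<in>C q. c j) = 0"
      by (simp add: c_def sum_subtractf)
    \<comment> \<open>Subtracting the cluster minimum \<open>m\<close> costs nothing because the
      coefficients sum to zero.\<close>
    then have "(\<Sum>j\<in>C q. c j * x $ j) = (\<Sum>j\<in>C q. c j * (x $ j - m))"
      by (simp add: right_diff_distrib sum_subtractf flip: sum_distrib_right)
    also have "\<dots> \<le> (\<Sum>j\<in>C q. max (c j) 0 * d)"
    proof (rule sum_mono)
      fix j
      assume "j \<in> C q"
      with m have "0 \<le> x $ j - m" "x $ j - m \<le> d" by force+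
      then show "c j * (x $ j - m) \<le> max (c j) 0 * d"
        by (intro order_trans [OF mult_right_mono mult_left_mono]) auto
    qed
    finally show ?thesis .
  qed simp
  have "(M *v x) $ i - (M *v x) $ i' = (\<Sum>j\<in>UNIV. c j * x $ j)"
    by (simp add: matrix_vector_mult_def c_def left_diff_distrib sum_subtractf)
  also have "\<dots> \<le> (\<Sum>j\<in>UNIV. max (c j) 0 * d)"
    unfolding sum_clusters [OF C] by (intro sum_mono cluster)
  \<comment> \<open>This uses \<open>max (a - b) 0 = a - min a b\<close> entry by entry.\<close>
  also have "\<dots> = (\<Sum>j\<in>UNIV. M $ i $ j - min (M $ i $ j) (M $ i' $ j)) * d"
    unfolding sum_distrib_right by (intro sum.cong) (auto simp: c_def)
  also have "\<dots> = (1 - (\<Sum>j\<in>UNIV. min (M $ i $ j) (M $ i' $ j))) * d"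
    using row by (simp add: sum_subtractf)
  also have "\<dots> \<le> (1 - \<delta>) * d"
  proof -
    have "\<delta> \<le> min (M $ i $ j0) (M $ i' $ j0)" using j0 by simp
    also have "\<dots> \<le> (\<Sum>j\<in>UNIV. min (M $ i $ j) (M $ i' $ j))"
      using nn by (intro member_le_sum) auto
    finally show ?thesis using d by (simp add: mult_right_mono)
  qed
  finally show ?thesis .
qed

section \<open>Trajectories and synchronization\<close>

text \<open>All inputs from time \<open>t\<close> on are collected in \<open>w\<close>. Each one is
  constant on clusters and remains so under the later matrices, so \<open>w\<close> cancels from
  intra-cluster differences.\<close>

lemma trajectory_transition:
  fixes C :: "'k::finite \<Rightarrow> 'n::finite set"
  assumes C: "clustering C" and A: "\<And>t. cluster_stochastic C (A t)"
    and I: "\<And>t. cluster_constant C (I t)"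
  shows "\<exists>w. cluster_constant C w \<and>
    trajectory A I x0 (t + k) = transition A t k *v trajectory A I x0 t + w"
proof (induction k arbitrary: t)
  case 0
  show ?case by (intro exI [of _ 0]) (simp add: cluster_constant_def)
next
  case (Suc k)
  obtain w where w: "cluster_constant C w"
    "trajectory A I x0 (Suc t + k) = transition A (Suc t) k *v trajectory A I x0 (Suc t) + w"
    using Suc by blast
  have "cluster_constant C (transition A (Suc t) k *v I t)"
    by (intro cluster_constant_mult cluster_stochastic_transition C A I)
  from cluster_constant_add [OF this w(1)]
  have "cluster_constant C (transition A (Suc t) k *v I t + w)" .
  moreover have "trajectory A I x0 (t + Suc k) =
      transition A t (Suc k) *v trajectory A I x0 t + (transition A (Suc t) k *v I t + w)"
    using w(2) by (simp add: matrix_vector_right_distrib matrix_vector_mul_assoc)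
  ultimately show ?case by blast
qed

theorem theorem3:
  fixes C :: "'k::finite \<Rightarrow> 'n::finite set"
    and \<Upsilon> :: "'n pair_pre_digraph set"
    and A :: "nat \<Rightarrow> real ^ 'n ^ 'n"
    and e :: real
    and \<alpha> :: "'k \<Rightarrow> real"
    and u :: "nat \<Rightarrow> real"
    and I :: "nat \<Rightarrow> real ^ 'n"
  assumes clustering: "clustering C"
    and graphs: "finite \<Upsilon>" "\<And>G. G \<in> \<Upsilon> \<Longrightarrow> pair_wf_digraph G \<and> pverts G = UNIV"
    and stochastic: "\<And>t. stochastic_matrix (A t)"
    and graph_in: "\<And>t. matrix_digraph (A t) \<in> \<Upsilon>"
    and cond_A: "\<And>p q.
      (\<forall>G\<in>\<Upsilon>. \<forall>w\<in>C q. \<forall>v\<in>C p. (w, v) \<notin> parcs G) \<or>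
      (\<forall>v\<in>C p. \<forall>G\<in>\<Upsilon>. \<exists>w\<in>C q. (w, v) \<in> parcs G)"
    and e_pos: "e > 0"
    and cond_B1: "\<And>i j t. A t $ i $ j = 0 \<or> A t $ i $ j \<ge> e"
    and cond_B2: "\<And>i t. A t $ i $ i \<ge> e"
    and cond_B3: "\<And>t. \<exists>B :: real ^ 'k ^ 'k. stochastic_matrix B \<and>
      (\<forall>p q. \<forall>i\<in>C p. (\<Sum>j\<in>C q. A t $ i $ j) = B $ p $ q)"
    and alpha_distinct: "inj \<alpha>"
    and input: "\<And>t p i. i \<in> C p \<Longrightarrow> I t $ i = \<alpha> p * u t"
    and spanning: "\<exists>L::nat. L > 0 \<and>
      (\<forall>t. has_cluster_spanning_trees (matrix_digraph (\<Sum>s\<in>{t..<t + L}. A s)) C)"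
  shows "intra_cluster_synchronizes C A I"
proof -
  obtain L where L: "L > 0"
    and tree: "\<And>t. has_cluster_spanning_trees (matrix_digraph (\<Sum>s\<in>{t..<t + L}. A s)) C"
    using spanning by blast
  have A: "cluster_stochastic C (A t)" for t
    using stochastic [of t] cond_B3 [of t] unfolding cluster_stochastic_def by metis
  have gap: "entries_gap e (A t)" for t
    using cond_B1 by (simp add: entries_gap_def)
  have diag: "0 < A t $ i $ i" for t i
    using cond_B2 e_pos by (rule less_le_trans [rotated])
  have I: "cluster_constant C (I t)" for t
    using input by (simp add: cluster_constant_def)
  \<comment> \<open>The length of \<open>Suc CARD('n)\<close> windows, after which any two rows of
    the same cluster share a positive column.\<close>
  define T where "T = Suc CARD('n) * L"
  have T: "T > 0" using L by (simp add: T_def)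
  \<comment> \<open>A lower bound for the positive entries of a product of \<open>T\<close> of the
    matrices, hence for the entries in a shared column.\<close>
  define \<delta> where "\<delta> = e ^ T"
  have "e \<le> 1"
    using cond_B2 stochastic_matrix_le_one [OF stochastic] by (rule order_trans)
  then have \<delta>: "0 < \<delta>" "\<delta> \<le> 1"
    using e_pos by (auto simp: \<delta>_def power_le_one)
  show ?thesis
    unfolding intra_cluster_synchronizes_def
  proof (intro allI ballI)
    fix x0 p i i'
    assume i: "i \<in> C p" "i' \<in> C p"
    let ?x = "trajectory A I x0"
    have diff: "?x (t + k) $ i - ?x (t + k) $ i' =
        (transition A t k *v ?x t) $ i - (transition A t k *v ?x t) $ i'"
      if "i \<in> C p" "i' \<in> C p" for t k p i i'
    proof -
      obtain w where w: "cluster_constant C w" "?x (t + k) = transition A t k *v ?x t + w"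
        using trajectory_transition [where A = A and I = I, OF clustering A I] by blast
      have "w $ i = w $ i'"
        using w(1) that unfolding cluster_constant_def by blast
      with w(2) show ?thesis by simp
    qed
    have M: "cluster_stochastic C (transition A t k)" for t k
      by (intro cluster_stochastic_transition clustering A)
    have mono: "cluster_diff_le C d (?x (t + k))" if d: "cluster_diff_le C d (?x t)" for t k d
      unfolding cluster_diff_le_def
    proof (intro allI ballI)
      fix p i i'
      assume i: "i \<in> C p" "i' \<in> C p"
      \<comment> \<open>The contraction estimate with factor \<open>1 - 0\<close>: for the bound 0
        any column serves as the shared one, and \<open>i\<close> is an arbitrary choice.\<close>
      have "(transition A t k *v ?x t) $ i - (transition A t k *v ?x t) $ i' \<le> (1 - 0) * d"
        using stochastic_transition [where A = A, OF stochastic]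
        by (intro cluster_diff_contraction [OF clustering M d i, where ?j0.0 = i])
          (auto simp: stochastic_matrix_def)
      then show "?x (t + k) $ i - ?x (t + k) $ i' \<le> d"
        using diff [OF i] by simp
    qed
    have contract: "cluster_diff_le C ((1 - \<delta>) * d) (?x (t + T))"
      if d: "cluster_diff_le C d (?x t)" for t d
      unfolding cluster_diff_le_def
    proof (intro allI ballI)
      fix p i i'
      assume i: "i \<in> C p" "i' \<in> C p"
      obtain j where "0 < transition A t T $ i $ j" "0 < transition A t T $ i' $ j"
        using supports_meet [where A = A, OF stochastic diag tree i] unfolding T_def by blast
      then have "\<delta> \<le> transition A t T $ i $ j" "\<delta> \<le> transition A t T $ i' $ j"
        using entries_gap_transition [where A = A, OF stochastic gap e_pos, of T t]
        unfolding entries_gap_def \<delta>_def by (metis less_irrefl)+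
      then show "?x (t + T) $ i - ?x (t + T) $ i' \<le> (1 - \<delta>) * d"
        unfolding diff [OF i]
        by (rule cluster_diff_contraction [OF clustering M d i])
    qed
    obtain d where d0: "cluster_diff_le C d x0"
    proof
      show "cluster_diff_le C (2 * norm x0) x0"
        unfolding cluster_diff_le_def
      proof (intro allI ballI)
        show "x0 $ i - x0 $ i' \<le> 2 * norm x0" for i i'
          using component_le_norm_cart [of x0 i] component_le_norm_cart [of x0 i'] by linarith
      qed
    qed
    have "cluster_diff_le C ((1 - \<delta>) ^ m * d) (?x (m * T))" for m
    proof (induction m)
      case (Suc m)
      from contract [OF this] show ?case by (simp add: mult.assoc add.commute)
    qed (use d0 in simp)
    \<comment> \<open>Time \<open>t\<close> consists of \<open>t div T\<close> complete blocks, each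
      of which contracts, and a remainder of \<open>t mod T\<close> steps, over which the
      differences do not increase.\<close>
    from mono [OF this] have bound: "cluster_diff_le C ((1 - \<delta>) ^ (t div T) * d) (?x t)" for t
      by (metis div_mult_mod_eq)
    \<comment> \<open>The number of complete blocks tends to infinity, and
      \<open>1 - \<delta>\<close> lies in the interval from 0 to 1 with 1 excluded, so the bound
      tends to 0.\<close>
    have "filterlim (\<lambda>t. t div T) sequentially sequentially"
      using T by (intro filterlim_at_top [THEN iffD2] allI eventually_sequentiallyI)
        (simp add: less_eq_div_iff_mult_less_eq)
    then have "(\<lambda>t. (1 - \<delta>) ^ (t div T)) \<longlonglongrightarrow> 0"
      using \<delta> by (intro filterlim_compose [OF LIMSEQ_power_zero]) auto
    then have lim: "(\<lambda>t. (1 - \<delta>) ^ (t div T) * d) \<longlonglongrightarrow> 0"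
      by (rule tendsto_mult_left_zero)
    show "(\<lambda>t. \<bar>?x t $ i - ?x t $ i'\<bar>) \<longlonglongrightarrow> 0"
    proof (rule tendsto_sandwich [OF _ _ tendsto_const lim])
      have "?x t $ i - ?x t $ i' \<le> (1 - \<delta>) ^ (t div T) * d"
        "?x t $ i' - ?x t $ i \<le> (1 - \<delta>) ^ (t div T) * d" for t
        using bound [of t] i unfolding cluster_diff_le_def by blast+
      then show "\<forall>\<^sub>F t in sequentially. \<bar>?x t $ i - ?x t $ i'\<bar> \<le> (1 - \<delta>) ^ (t div T) * d"
        by (intro always_eventually allI abs_leI) simp_all
    qed simp
  qed
qed

end
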